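(* Consider a finite connected dissipative flow network $\mathcal{G}=(\mathcal{V},\mathcal{E})$ with reference node $0\in\mathcal{V}$ whose potential is fixed at $\pi_0=c$, and let $\mathcal{V}'=\mathcal{V}\setminus\{0\}$. Let $x=(x_i)_{i\in\mathcal{V}'}\in\mathbb{R}^{\mathcal{V}'}$ and $b=(b_{ij})_{(i,j)\in\mathcal{E}}\in\mathbb{R}^{\mathcal{E}}$, and put $x_0=-\sum_{i\in\mathcal{V}'}x_i$. With $E$, $E^*$, $F_{ij}$, $G_{ij}$, $g_{ij}$ as defined in the context, let $\phi^*$ be the unique optimum of $$\min_{\phi}\ \sum_{(i,j)\in\mathcal{E}}\bigl(F_{ij}(\phi_{ij})-b_{ij}\phi_{ij}\bigr)\quad\text{s.t.}\quad\sum_{j\in\partial i}\phi_{ij}=x_i\ \ \forall i\in\mathcal{V},$$ and let $\pi^*\in\mathbb{R}^{\mathcal{V}'}$ be the unique optimum of $\max_{\pi\in\mathbb{R}^{\mathcal{V}'}}\bigl[\pi^Tx-E(\pi,b)\bigr]$. Then: (a) $\nabla_xE^*(x,b)=\pi^*$ and $\nabla_bE^*(x,b)=-\phi^*$. (b) The Hessian of $E^*$ with respect to $x$ is $$\nabla^2_{xx}E^*(x,b)=\bigl(\nabla^2_{\pi\pi}E(\pi,b)\bigr)^{-1}\quad\text{at }\pi=\pi^*,$$ where for $i\neq j$ in $\mathcal{V}'$ joined by an edge $\bigl[\nabla^2_{\pi\pi}E(\pi,b)\bigr]_{ij}=-g_{ij}'(\pi_i-\pi_j+b_{ij})$ (and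 this entry is $0$ if $i\ne j$ are not joined by an edge), and for $i\in\mathcal{V}'$ $\bigl[\nabla^2_{\pi\pi}E(\pi,b)\bigr]_{ii}=\sum_{j\in\partial i}g_{ij}'(\pi_i-\pi_j+b_{ij})$. (c) For given $x,b$, the inequality $E(\pi,b)+E^*(x,b)-\pi^Tx\le 0$ has exactly one solution $\pi\in\mathbb{R}^{\mathcal{V}'}$, given by $\pi=\pi^*=\nabla_xE^*(x,b)$.
   Context: A dissipative flow network consists of a finite connected undirected graph $\mathcal{G}=(\mathcal{V},\mathcal{E})$ in which each edge has a fixed nominal orientation $i\to j$, written $(i,j)\in\mathcal{E}$ (each edge appears in $\mathcal{E}$ once). Each edge carries a flow $\phi_{ij}\in\mathbb{R}$ with $\phi_{ji}=-\phi_{ij}$, and each node a potential $\pi_i\in\mathbb{R}$. $\partial i$ is the set of neighbours of $i$. Each edge has a dissipation function $f_{ij}:\mathbb{R}\to\mathbb{R}$ that is odd, differentiable and strictly monotonically increasing, and a parameter $b_{ij}\in\mathbb{R}$; by convention $b_{ji}=-b_{ij}$ and $f_{ji}=f_{ij}$. Let $F_{ij}$ be an anti-derivative of $f_{ij}$. Being monotonically increasing, $f_{ij}$ is invertible; let $g_{ij}=f_{ij}^{-1}$ denote its inverse and let $G_{ij}(y)=y\,g_{ij}(y)-F_{ij}(g_{ij}(y))$, an anti-derivative of $g_{ij}$. The potential of node $0$ is fixed to a constant $\pi_0=c$, and the remaining potentials form $\pi\in\mathbb{R}^{\mathcal{V}'}$, $\mathcal{V}'=\mathcal{V}\setminus\{0\}$.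 Define $$E(\pi,b)=\sum_{(i,j)\in\mathcal{E}}G_{ij}(\pi_i-\pi_j+b_{ij})\quad(\text{with }\pi_0=c),\qquad E^*(x,b)=\sup_{\pi}\bigl[\pi^Tx-E(\pi,b)\bigr],\quad \pi^Tx=\sum_{i\in\mathcal{V}'}\pi_ix_i.$$
   Formalization: Each f_ij is assumed to be a bijection of R (arctan would leave E undefined), and (b) is stated where every g_ij is differentiable at π_i−π_j+b_ij (for E*, at π* ), since f(y)=y³ with x=b=c=0 gives g' and the Hessian of E undefined. *)

theory Defs
  imports "HOL-Analysis.Analysis"
begin

text \<open>
  The node set is \<open>'n option\<close>: \<open>None\<close> is the reference node 0 and \<open>'n\<close> indexes the
  remaining nodes, so that potentials and injections on \<open>V'\<close> are vectors in \<open>real ^ 'n\<close>.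
  The type \<open>'e\<close> indexes the edges, and \<open>ends e = (i, j)\<close> says that the edge \<open>e\<close> joins
  \<open>i\<close> and \<open>j\<close> and has the nominal orientation from \<open>i\<close> to \<open>j\<close>; flows and edge parameters
  are vectors in \<open>real ^ 'e\<close>.
\<close>

definition neighbours :: "('e \<Rightarrow> 'v \<times> 'v) \<Rightarrow> 'v \<Rightarrow> 'v set" where
  "neighbours ends i = {j. (i, j) \<in> range ends \<or> (j, i) \<in> range ends}"

text \<open>
  The graph is simple (no loops, each undirected edge listed once). The inverse of \<open>f e\<close>
  must be defined on all of the reals for the energy below to make sense, and strict
  monotonicity alone does not give this; hence the condition \<open>bij (f e)\<close>.
  The antiderivatives \<open>F e\<close> are arbitrary, that is, the constant of integration is free.
\<close>

locale dissipative_flow_network =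
  fixes ends :: "'e::finite \<Rightarrow> 'v::finite \<times> 'v"
    and f F :: "'e \<Rightarrow> real \<Rightarrow> real"
  assumes no_loops: "fst (ends e) \<noteq> snd (ends e)"
    and edges_once: "inj (\<lambda>e. {fst (ends e), snd (ends e)})"
    and connected: "(i, j) \<in> (range ends \<union> (range ends)\<inverse>)\<^sup>*"
    and f_odd: "f e (- y) = - f e y"
    and f_differentiable: "f e differentiable (at y)"
    and f_strict_mono: "strict_mono (f e)"
    and f_invertible: "bij (f e)"
    and F_antiderivative: "(F e has_real_derivative f e y) (at y)"

definition edge_joining :: "('e \<Rightarrow> 'v \<times> 'v) \<Rightarrow> 'v \<Rightarrow> 'v \<Rightarrow> 'e" where
  "edge_joining ends i j = (THE e. ends e = (i, j) \<or> ends e = (j, i))"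

text \<open>
  The antisymmetric doubly indexed quantities \<open>\<phi>\<^sub>i\<^sub>j = - \<phi>\<^sub>j\<^sub>i\<close> and
  \<open>b\<^sub>i\<^sub>j = - b\<^sub>j\<^sub>i\<close>; only meaningful if \<open>i\<close> and \<open>j\<close> are joined by an edge.
\<close>

definition signed :: "('e::finite \<Rightarrow> 'v \<times> 'v) \<Rightarrow> real ^ 'e \<Rightarrow> 'v \<Rightarrow> 'v \<Rightarrow> real" where
  "signed ends w i j =
     (let e = edge_joining ends i j in if ends e = (i, j) then w $ e else - (w $ e))"

definition g :: "('e \<Rightarrow> real \<Rightarrow> real) \<Rightarrow> 'e \<Rightarrow> real \<Rightarrow> real" where
  "g f e = inv (f e)"

definition G :: "('e \<Rightarrow> real \<Rightarrow> real) \<Rightarrow> ('e \<Rightarrow> real \<Rightarrow> real) \<Rightarrow> 'e \<Rightarrow> real \<Rightarrow> real" where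
  "G f F e y = y * g f e y - F e (g f e y)"

definition potential :: "real \<Rightarrow> real ^ 'n \<Rightarrow> 'n option \<Rightarrow> real" where
  "potential c \<pi> i = (case i of None \<Rightarrow> c | Some k \<Rightarrow> \<pi> $ k)"

definition injection :: "real ^ 'n::finite \<Rightarrow> 'n option \<Rightarrow> real" where
  "injection x i = (case i of None \<Rightarrow> - (\<Sum>k\<in>UNIV. x $ k) | Some k \<Rightarrow> x $ k)"

definition edge_arg ::
    "('e::finite \<Rightarrow> 'n option \<times> 'n option) \<Rightarrow> real \<Rightarrow> real ^ 'n \<Rightarrow> real ^ 'e \<Rightarrow> 'e \<Rightarrow> real" where
  "edge_arg ends c \<pi> b e =
     potential c \<pi> (fst (ends e)) - potential c \<pi> (snd (ends e)) + b $ e"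

definition energy ::
    "('e::finite \<Rightarrow> 'n option \<times> 'n option) \<Rightarrow> ('e \<Rightarrow> real \<Rightarrow> real) \<Rightarrow> ('e \<Rightarrow> real \<Rightarrow> real) \<Rightarrow>
     real \<Rightarrow> real ^ 'n \<Rightarrow> real ^ 'e \<Rightarrow> real" where
  "energy ends f F c \<pi> b = (\<Sum>e\<in>UNIV. G f F e (edge_arg ends c \<pi> b e))"

definition energy_conj ::
    "('e::finite \<Rightarrow> 'n::finite option \<times> 'n option) \<Rightarrow> ('e \<Rightarrow> real \<Rightarrow> real) \<Rightarrow>
     ('e \<Rightarrow> real \<Rightarrow> real) \<Rightarrow> real \<Rightarrow> real ^ 'n \<Rightarrow> real ^ 'e \<Rightarrow> real" where
  "energy_conj ends f F c x b = (SUP \<pi>. \<pi> \<bullet> x - energy ends f F c \<pi> b)"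

definition flow_cost :: "('e::finite \<Rightarrow> real \<Rightarrow> real) \<Rightarrow> real ^ 'e \<Rightarrow> real ^ 'e \<Rightarrow> real" where
  "flow_cost F b \<phi> = (\<Sum>e\<in>UNIV. F e (\<phi> $ e) - b $ e * \<phi> $ e)"

definition flow_feasible ::
    "('e::finite \<Rightarrow> 'n::finite option \<times> 'n option) \<Rightarrow> real ^ 'n \<Rightarrow> real ^ 'e \<Rightarrow> bool" where
  "flow_feasible ends x \<phi> \<longleftrightarrow>
     (\<forall>i. (\<Sum>j\<in>neighbours ends i. signed ends \<phi> i j) = injection x i)"

definition has_hessian :: "(real ^ 'n \<Rightarrow> real) \<Rightarrow> real ^ 'n ^ 'n \<Rightarrow> real ^ 'n::finite \<Rightarrow> bool" where
  "has_hessian h H x \<longleftrightarrow>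
     (\<exists>D. (\<forall>\<^sub>F y in nhds x. GDERIV h y :> D y) \<and> (D has_derivative (\<lambda>v. H *v v)) (at x))"

definition dg ::
    "('e::finite \<Rightarrow> 'n option \<times> 'n option) \<Rightarrow> ('e \<Rightarrow> real \<Rightarrow> real) \<Rightarrow> real \<Rightarrow>
     real ^ 'n \<Rightarrow> real ^ 'e \<Rightarrow> 'n option \<Rightarrow> 'n option \<Rightarrow> real" where
  "dg ends f c \<pi> b i j =
     deriv (g f (edge_joining ends i j)) (potential c \<pi> i - potential c \<pi> j + signed ends b i j)"

definition energy_hessian ::
    "('e::finite \<Rightarrow> 'n::finite option \<times> 'n option) \<Rightarrow> ('e \<Rightarrow> real \<Rightarrow> real) \<Rightarrow> real \<Rightarrow>
     real ^ 'n \<Rightarrow> real ^ 'e \<Rightarrow> real ^ 'n ^ 'n" where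
  "energy_hessian ends f c \<pi> b =
     (\<chi> i j. if i = j then \<Sum>k\<in>neighbours ends (Some i). dg ends f c \<pi> b (Some i) k
             else if Some j \<in> neighbours ends (Some i) then - dg ends f c \<pi> b (Some i) (Some j)
             else 0)"

text \<open>
  The hypotheses do not exclude a vanishing derivative of \<open>f e\<close> (for instance
  \<open>f e y = y * \<bar>y\<bar>\<close> at 0), in which case \<open>g f e\<close> has no derivative at the corresponding
  point and the Hessian of the energy does not exist there.
\<close>

definition g_differentiable_at ::
    "('e::finite \<Rightarrow> 'n option \<times> 'n option) \<Rightarrow> ('e \<Rightarrow> real \<Rightarrow> real) \<Rightarrow> real \<Rightarrow>
     real ^ 'n \<Rightarrow> real ^ 'e \<Rightarrow> bool" where
  "g_differentiable_at ends f c \<pi> b \<longleftrightarrow>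
     (\<forall>e. g f e differentiable (at (edge_arg ends c \<pi> b e)))"

end

theory Submission
  imports Defs
begin

text \<open>
  Let \<open>A\<close> be the incidence matrix of the graph, with the reference node left out. The
  arguments of the edge energies are \<open>y = A (\<pi> - c) + b\<close>, and the gradient of the energy is
  \<open>\<nabla>E(\<pi>) = A\<^sup>T g(y)\<close>: the divergence of the flow \<open>g(y)\<close> that the potential
  induces. Everything rests on three facts.

  Firstly, on each edge \<open>F\<close> and \<open>G\<close> are strictly convex and conjugate to each other, with
  the Fenchel inequality \<open>y u \<le> F u + G y\<close>, an equality exactly for \<open>u = g y\<close>. Connectedness
  makes \<open>A\<close> injective, so that \<open>E\<close> is strictly convex and grows faster than any linear
  function. Hence \<open>\<nabla>E\<close> is a bijection (\<open>inj_energy_gradient\<close>,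
  \<open>surj_energy_gradient\<close>): for every \<open>x\<close> there is exactly one \<open>\<pi>\<^sup>*\<close> whose induced flow
  \<open>\<phi>\<^sup>*\<close> has divergence \<open>x\<close>.

  Secondly, adding the Fenchel inequalities over all edges bounds each value of the dual objective
  \<open>\<pi>\<^sup>T x - E(\<pi>, b)\<close> by the cost of each feasible flow, up to the contribution of the reference
  potential (\<open>weak_duality\<close>), with equality for \<open>\<pi>\<^sup>*\<close> and \<open>\<phi>\<^sup>*\<close> (\<open>strong_duality\<close>).
  So both are optimal, and \<open>E\<^sup>*\<close> is trapped between the dual objective at the fixed potential
  \<open>\<pi>\<^sup>*\<close> and the cost of a suitably perturbed \<open>\<phi>\<^sup>*\<close>, two differentiable functions of \<open>(x, b)\<close>
  that touch it. Its gradient \<open>(\<pi>\<^sup>*, - \<phi>\<^sup>*)\<close> is that of the bounds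
  (\<open>energy_conj_has_derivative\<close>).

  Thirdly, the gradient map of \<open>E\<^sup>*\<close> in \<open>x\<close> is therefore the inverse of \<open>\<nabla>E\<close>. Where
  \<open>g\<close> is differentiable, \<open>\<nabla>E\<close> has the derivative \<open>A\<^sup>T diag(g') A\<close>, which is positive
  definite because \<open>g' > 0\<close> and \<open>A\<close> is injective, and the inverse function theorem gives the
  Hessian of \<open>E\<^sup>*\<close> (\<open>has_hessian_energy_conj\<close>). The inequality in the last claim says
  that \<open>\<pi>\<close> attains the supremum \<open>E\<^sup>*\<close>.
\<close>

text \<open>
  Neither \<open>G\<close>, which involves an inverse function, nor the supremum \<open>E\<^sup>*\<close> can be differentiated
  by the usual rules; for both, convex duality provides differentiable bounds that touch at the
  point in question.
\<close>

lemma has_derivative_sandwich: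
  fixes h l u :: "'a::real_normed_vector \<Rightarrow> real"
  assumes l: "(l has_derivative D) (at x)" and u: "(u has_derivative D) (at x)"
    and bounds: "\<And>y. l y \<le> h y" "\<And>y. h y \<le> u y"
    and touch: "l x = h x" "u x = h x"
  shows "(h has_derivative D) (at x)"
proof -
  let ?r = "\<lambda>k y. norm (k y - k x - D (y - x)) / norm (y - x)"
  have lim: "(\<lambda>y. ?r l y + ?r u y) \<midarrow>x\<rightarrow> 0"
    using l u tendsto_add[of "?r l" 0 "at x" "?r u" 0] by (simp add: has_derivative_iff_norm)
  have "norm (h y - h x - D (y - x)) \<le> norm (l y - l x - D (y - x)) + norm (u y - u x - D (y - x))" for y
    using bounds[of y] touch by (simp add: abs_if)
  then have "?r h y \<le> ?r l y + ?r u y" for y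
    by (simp flip: add_divide_distrib add: divide_right_mono)
  then have "?r h \<midarrow>x\<rightarrow> 0"
    by (intro tendsto_sandwich[OF _ _ tendsto_const lim]) auto
  then show ?thesis
    using l by (simp add: has_derivative_iff_norm)
qed

section \<open>Edge energies as convex conjugates\<close>

context dissipative_flow_network
begin

lemma f_less_iff: "f e u < f e v \<longleftrightarrow> u < v"
  using f_strict_mono strict_mono_less by blast

lemma f_g [simp]: "f e (g f e y) = y"
  unfolding g_def using f_invertible by (simp add: bij_is_surj surj_f_inv_f)

lemma g_f [simp]: "g f e (f e u) = u"
  unfolding g_def using f_invertible by (simp add: bij_is_inj)

lemma g_less_iff: "g f e y < g f e z \<longleftrightarrow> y < z"
  using f_less_iff[of e "g f e y" "g f e z"] by simp

lemma g_eq_iff: "g f e y = g f e z \<longleftrightarrow> y = z"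
  by (metis f_g)

lemma g_odd: "g f e (- y) = - g f e y"
  by (metis f_g f_odd g_f)

text \<open>
  A monotone function whose image is open is continuous.
\<close>

lemma isCont_g: "isCont (g f e) y"
proof -
  have "surj (g f e)"
    by (metis g_f surjI)
  then have "continuous_on UNIV (g f e)"
    using g_less_iff by (intro continuous_onI_mono) (auto simp: le_less)
  then show ?thesis
    by (simp add: continuous_on_eq_continuous_at)
qed

text \<open>
  Strict convexity of \<open>F\<close>, from the mean value theorem and the strict monotonicity of its
  derivative \<open>f\<close>.
\<close>

lemma F_above_tangent:
  assumes "v \<noteq> u"
  shows "F e u + f e u * (v - u) < F e v"
proof (cases "u < v")
  case True
  then obtain z where "u < z" "z < v" and z: "F e v - F e u = (v - u) * f e z"
    using MVT2[of u v "F e" "f e"] F_antiderivative by blast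
  then have "(v - u) * f e u < (v - u) * f e z"
    using True f_less_iff by simp
  with z show ?thesis
    by (simp add: algebra_simps)
next
  case False
  then have "v < u"
    using assms by simp
  then obtain z where "v < z" "z < u" and z: "F e u - F e v = (u - v) * f e z"
    using MVT2[of v u "F e" "f e"] F_antiderivative by blast
  then have "(u - v) * f e z < (u - v) * f e u"
    using f_less_iff by simp
  with z show ?thesis
    by (simp add: algebra_simps)
qed

lemma fenchel_eq: "y * g f e y = F e (g f e y) + G f F e y"
  by (simp add: G_def)

text \<open>
  The tangent of \<open>F\<close> at \<open>g y\<close> has slope \<open>y\<close>, and \<open>F\<close> lies above it; \<open>- G y\<close> is the
  intercept of this tangent.
\<close>

lemma fenchel_strict:
  assumes "u \<noteq> g f e y"
  shows "y * u < F e u + G f F e y"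
  using F_above_tangent[OF assms, of e] by (simp add: G_def algebra_simps)

lemma fenchel: "y * u \<le> F e u + G f F e y"
  using fenchel_strict[of u e y] fenchel_eq[of y e] by (cases "u = g f e y") auto

lemma G_above_tangent:
  assumes "z \<noteq> y"
  shows "G f F e y + g f e y * (z - y) < G f F e z"
proof -
  have "z * g f e y < F e (g f e y) + G f F e z"
    using assms by (intro fenchel_strict) (simp add: g_eq_iff)
  then show ?thesis
    using fenchel_eq[of y e] by (simp add: algebra_simps)
qed

text \<open>
  \<open>f\<close> may have critical points, and then \<open>g\<close> is not differentiable and \<open>G\<close> cannot be
  differentiated by the product and chain rules. The tangent inequality, used once at \<open>y\<close> and
  once at \<open>z\<close>, instead traps \<open>G z\<close> between two functions that agree with \<open>G\<close> at \<open>y\<close>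
  and have slope \<open>g y\<close> there: the upper one has the difference quotient \<open>g z\<close>, which
  tends to \<open>g y\<close> because \<open>g\<close> is continuous.
\<close>

lemma G_has_derivative: "(G f F e has_real_derivative g f e y) (at y)"
proof -
  have tangent: "G f F e v + g f e v * (w - v) \<le> G f F e w" for v w
    using G_above_tangent[of w v e] by (cases "w = v") auto
  have "((\<lambda>z. G f F e y + g f e y * (z - y)) has_derivative (*) (g f e y)) (at y)"
    by (auto intro!: derivative_eq_intros)
  moreover have "((\<lambda>z. G f F e y + g f e z * (z - y)) has_derivative (*) (g f e y)) (at y)"
  proof -
    have "((\<lambda>z. G f F e y + g f e z * (z - y)) has_real_derivative g f e y) (at y)"
      unfolding CARAT_DERIV by (rule exI[of _ "g f e"]) (auto simp: isCont_g)
    then show ?thesis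
      by (simp add: has_field_derivative_def)
  qed
  ultimately show ?thesis
    unfolding has_field_derivative_def
  proof (rule has_derivative_sandwich)
    show "G f F e z \<le> G f F e y + g f e z * (z - y)" for z
      using tangent[of z y] by (simp add: algebra_simps)
  qed (use tangent in auto)
qed

text \<open>
  The Fenchel inequality at the two flows \<open>M\<close> and \<open>- M\<close>. Since \<open>M\<close> is arbitrary,
  \<open>G\<close> grows faster than any linear function.
\<close>

lemma G_coercive:
  assumes "0 \<le> M"
  shows "M * \<bar>y\<bar> \<le> G f F e y + max (F e M) (F e (- M))"
  using fenchel[of y M e] fenchel[of y "- M" e] by (cases "0 \<le> y") (auto simp: algebra_simps)

text \<open>
  The chain rule in \<open>f (g y) = y\<close> excludes \<open>g' = 0\<close>: where \<open>g\<close> is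
  differentiable its derivative is strictly positive, which is what makes the Hessian of the
  energy positive definite and not merely semidefinite.
\<close>

lemma deriv_g_pos:
  assumes "g f e differentiable (at y)"
  shows "0 < deriv (g f e) y"
proof -
  have g': "(g f e has_real_derivative deriv (g f e) y) (at y)"
    using assms by (simp add: DERIV_deriv_iff_real_differentiable)
  obtain f' where f': "(f e has_real_derivative f') (at (g f e y))"
    using f_differentiable by (meson real_differentiable_def)
  have "((\<lambda>z. f e (g f e z)) has_real_derivative f' * deriv (g f e) y) (at y)"
    by (rule DERIV_chain2[OF f' g'])
  then have "f' * deriv (g f e) y = 1"
    using DERIV_unique[OF _ DERIV_ident[of "at y"]] by simp
  then have "deriv (g f e) y \<noteq> 0"
    by auto
  moreover have "0 \<le> deriv (g f e) y"
  proof -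
    have "mono (g f e)"
      by (auto simp: mono_def le_less g_less_iff)
    then have "mono_on UNIV (g f e)" by simp
    then show ?thesis
      using g' mono_on_imp_deriv_nonneg by auto
  qed
  ultimately show ?thesis
    by simp
qed

text \<open>
  The value \<open>g\<^sub>i\<^sub>j'(\<pi>\<^sub>i - \<pi>\<^sub>j + b\<^sub>i\<^sub>j)\<close> does not depend on the
  direction in which an edge is traversed, so it may be read off in the nominal orientation.
\<close>

lemma deriv_g_even:
  assumes "g f e differentiable (at y)"
  shows "deriv (g f e) (- y) = deriv (g f e) y"
proof -
  have "(g f e has_real_derivative deriv (g f e) y) (at y)"
    using assms by (simp add: DERIV_deriv_iff_real_differentiable)
  then have "((\<lambda>z. - g f e (- z)) has_real_derivative deriv (g f e) y) (at (- y))"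
    by (auto intro!: derivative_eq_intros DERIV_chain2[of "g f e"])
  then show ?thesis
    by (simp add: g_odd DERIV_imp_deriv)
qed

section \<open>Sums over neighbours as sums over edges\<close>

lemma edge_joining_ends:
  assumes "ends e = (i, j)"
  shows "edge_joining ends i j = e" "edge_joining ends j i = e"
proof -
  have unique: "e' = e" if "ends e' = (i, j) \<or> ends e' = (j, i)" for e'
  proof (rule injD[OF edges_once])
    show "{fst (ends e'), snd (ends e')} = {fst (ends e), snd (ends e)}"
      using that assms by auto
  qed
  show "edge_joining ends i j = e"
    unfolding edge_joining_def by (rule the_equality) (use assms unique in blast)+
  show "edge_joining ends j i = e"
    unfolding edge_joining_def by (rule the_equality) (use assms unique in blast)+
qed

lemma signed_ends:
  assumes "ends e = (i, j)"
  shows "signed ends w i j = w $ e" "signed ends w j i = - w $ e"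
  using assms no_loops[of e] by (auto simp: signed_def Let_def edge_joining_ends[OF assms])

text \<open>
  As the graph is simple, the neighbours of \<open>i\<close> correspond one-to-one to the edges at \<open>i\<close>.
  An edge at \<open>i\<close> contributes through exactly one of the two summands, according to whether it leaves
  or enters \<open>i\<close>.
\<close>

lemma sum_neighbours:
  "(\<Sum>j\<in>neighbours ends i. h j) =
    (\<Sum>e\<in>UNIV. of_bool (fst (ends e) = i) * h (snd (ends e)) + of_bool (snd (ends e) = i) * h (fst (ends e)))"
  for h :: "'v \<Rightarrow> real"
proof -
  let ?I = "{e. fst (ends e) = i \<or> snd (ends e) = i}"
  let ?other = "\<lambda>e. if fst (ends e) = i then snd (ends e) else fst (ends e)"
  have "(\<Sum>j\<in>neighbours ends i. h j) = (\<Sum>e\<in>?I. h (?other e))"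
  proof (rule sum.reindex_bij_witness[of _ ?other "edge_joining ends i"])
    fix j assume "j \<in> neighbours ends i"
    then obtain e where e: "ends e = (i, j) \<or> ends e = (j, i)"
      unfolding neighbours_def by force
    then have "edge_joining ends i j = e"
      using edge_joining_ends by blast
    then show "?other (edge_joining ends i j) = j" "edge_joining ends i j \<in> ?I"
        "h (?other (edge_joining ends i j)) = h j"
      using e by auto
  next
    fix e assume e: "e \<in> ?I"
    obtain k l where kl: "ends e = (k, l)" by fastforce
    then have "(k, l) \<in> range ends"
      by (metis rangeI)
    then show "edge_joining ends i (?other e) = e" "?other e \<in> neighbours ends i"
      using e kl edge_joining_ends[OF kl] by (auto simp: neighbours_def)
  qed
  also have "\<dots> = (\<Sum>e\<in>?I. of_bool (fst (ends e) = i) * h (snd (ends e)) + of_bool (snd (ends e) = i) * h (fst (ends e)))"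
  proof (intro sum.cong refl)
    fix e assume "e \<in> ?I"
    then show "h (?other e) = of_bool (fst (ends e) = i) * h (snd (ends e)) + of_bool (snd (ends e) = i) * h (fst (ends e))"
      using no_loops[of e] by auto
  qed
  also have "\<dots> = (\<Sum>e\<in>UNIV. of_bool (fst (ends e) = i) * h (snd (ends e)) + of_bool (snd (ends e) = i) * h (fst (ends e)))"
    by (rule sum.mono_neutral_left) auto
  finally show ?thesis .
qed

end

section \<open>The incidence matrix\<close>

definition orientation :: "('e \<Rightarrow> 'v \<times> 'v) \<Rightarrow> 'v \<Rightarrow> 'e \<Rightarrow> real" where
  "orientation ends i e = of_bool (fst (ends e) = i) - of_bool (snd (ends e) = i)"

definition incidence :: "('e::finite \<Rightarrow> 'n::finite option \<times> 'n option) \<Rightarrow> real ^ 'n ^ 'e" where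
  "incidence ends = (\<chi> e k. orientation ends (Some k) e)"

lemma incidence_mult:
  "(incidence ends *v p) $ e = potential 0 p (fst (ends e)) - potential 0 p (snd (ends e))"
proof -
  have "(\<Sum>k\<in>UNIV. of_bool (i = Some k) * p $ k) = potential 0 p i" for i
  proof (cases i)
    case (Some l)
    then show ?thesis
      by (simp add: potential_def of_bool_def if_distrib[of "\<lambda>t. t * _"] cong: if_cong)
  qed (simp add: potential_def)
  then show ?thesis
    by (simp add: incidence_def orientation_def matrix_vector_mult_def left_diff_distrib sum_subtractf)
qed

text \<open>
  Potentials enter only through differences along edges, so fixing the reference potential to
  \<open>c\<close> has the same effect as fixing it to 0 and lowering all others by \<open>c\<close>.
\<close>

lemma edge_arg_incidence:
  "edge_arg ends c p b e = (incidence ends *v (p - (\<chi> k. c)) + b) $ e"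
  by (simp add: edge_arg_def incidence_mult potential_def split: option.split)

lemma inner_incidence:
  "(incidence ends *v p) \<bullet> \<phi> = p \<bullet> (transpose (incidence ends) *v \<phi>)"
  unfolding transpose_matrix_vector using dot_lmul_matrix[of \<phi> "incidence ends" p] by (simp add: inner_commute)

lemma (in dissipative_flow_network) divergence_orientation:
  "(\<Sum>j\<in>neighbours ends i. signed ends \<phi> i j) = (\<Sum>e\<in>UNIV. orientation ends i e * \<phi> $ e)"
proof -
  have "signed ends \<phi> (fst (ends e)) (snd (ends e)) = \<phi> $ e"
    "signed ends \<phi> (snd (ends e)) (fst (ends e)) = - \<phi> $ e" for e
    using signed_ends[of e "fst (ends e)" "snd (ends e)"] by simp_all
  then have "of_bool (fst (ends e) = i) * signed ends \<phi> i (snd (ends e)) +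
      of_bool (snd (ends e) = i) * signed ends \<phi> i (fst (ends e)) = orientation ends i e * \<phi> $ e" for e
    using no_loops[of e] by (cases "fst (ends e) = i"; cases "snd (ends e) = i") (auto simp: orientation_def)
  then show ?thesis
    unfolding sum_neighbours by simp
qed

text \<open>
  Divergences are written \<open>transpose A *v \<phi>\<close>; the simplifier would turn this into
  \<open>\<phi> v* A\<close>.
\<close>

declare transpose_matrix_vector [simp del]

locale grounded_flow_network = dissipative_flow_network ends f F
  for ends :: "'e::finite \<Rightarrow> 'n::finite option \<times> 'n option" and f F +
  fixes c :: real
begin

abbreviation "A \<equiv> incidence ends"

abbreviation "E \<equiv> energy ends f F c"

abbreviation ground :: "real ^ 'n" where "ground \<equiv> (\<chi> k. c)"

definition induced_flow :: "real ^ 'n \<Rightarrow> real ^ 'e \<Rightarrow> real ^ 'e" where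
  "induced_flow p b = (\<chi> e. g f e (edge_arg ends c p b e))"

text \<open>
  A potential in the kernel is constant along edges, hence constant on the connected graph, and
  it vanishes at the reference node.
\<close>

lemma inj_incidence: "inj ((*v) A)"
proof -
  have "p = 0" if "A *v p = 0" for p :: "real ^ 'n"
  proof -
    have edge: "potential 0 p (fst (ends e)) = potential 0 p (snd (ends e))" for e
      using arg_cong[OF that, of "\<lambda>w. w $ e"] by (simp add: incidence_mult)
    have "potential 0 p i = potential 0 p j" if "(i, j) \<in> (range ends \<union> (range ends)\<inverse>)\<^sup>*" for i j
      using that
    proof induction
      case (step j k)
      then obtain e where "ends e = (j, k) \<or> ends e = (k, j)" by auto metis+
      then show ?case using edge[of e] step.IH by auto
    qed simp
    from this[OF connected, of "Some k" None for k] show "p = 0"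
      by (simp add: potential_def vec_eq_iff)
  qed
  then show ?thesis
    by (simp add: linear_injective_0)
qed

text \<open>
  The balance at the reference node follows from the others: every edge leaves one node and
  enters another, so the divergences of a flow sum to 0, as do the injections.
\<close>

lemma flow_feasible_iff: "flow_feasible ends x \<phi> \<longleftrightarrow> transpose A *v \<phi> = x"
proof -
  have div: "(transpose A *v \<phi>) $ k = (\<Sum>e\<in>UNIV. orientation ends (Some k) e * \<phi> $ e)" for k
    by (simp add: matrix_vector_mult_def transpose_def incidence_def)
  have total: "(\<Sum>k\<in>UNIV. orientation ends (Some k) e) = - orientation ends None e" for e
  proof -
    have "(\<Sum>k\<in>UNIV. of_bool (i = Some k)) = (1 - of_bool (i = None) :: real)" for i :: "'n option"
      by (cases i) (simp_all add: of_bool_def)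
    from this[of "fst (ends e)"] this[of "snd (ends e)"] show ?thesis
      unfolding orientation_def sum_subtractf by (simp add: sum_subtractf)
  qed
  have "(\<Sum>e\<in>UNIV. orientation ends None e * \<phi> $ e) = - (\<Sum>k\<in>UNIV. (transpose A *v \<phi>) $ k)"
  proof -
    have "(\<Sum>k\<in>UNIV. (transpose A *v \<phi>) $ k) = (\<Sum>e\<in>UNIV. (\<Sum>k\<in>UNIV. orientation ends (Some k) e) * \<phi> $ e)"
      unfolding div sum_distrib_right by (rule sum.swap)
    then show ?thesis
      by (simp add: total sum_negf)
  qed
  then show ?thesis
    unfolding flow_feasible_def divergence_orientation injection_def split_option_all
    by (auto simp: div vec_eq_iff)
qed

section \<open>Convexity and coercivity of the energy\<close>

text \<open>
  Strict convexity of \<open>E\<close> in \<open>\<pi>\<close>: by injectivity of the incidence matrix two different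
  potentials differ along some edge, and the tangent inequality for that edge is strict. The
  gradient of \<open>E\<close> at \<open>p\<close> is the divergence of the flow induced by \<open>p\<close>, so a potential is
  optimal for \<open>x\<close> exactly if its induced flow is feasible for \<open>x\<close>.
\<close>

lemma energy_above_tangent:
  assumes "q \<noteq> p"
  shows "E p b + (q - p) \<bullet> (transpose A *v induced_flow p b) < E q b"
proof -
  let ?y = "edge_arg ends c p b" and ?z = "edge_arg ends c q b"
  have diff: "?z e - ?y e = (A *v (q - p)) $ e" for e
    by (simp add: edge_arg_incidence matrix_vector_mult_diff_distrib)
  have "A *v q \<noteq> A *v p"
    using assms inj_incidence by (simp add: inj_eq)
  then obtain e where "?z e \<noteq> ?y e"
    using diff by (metis eq_iff_diff_eq_0 matrix_vector_mult_diff_distrib vec_eq_iff zero_index)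
  then have "(\<Sum>e\<in>UNIV. G f F e (?y e) + g f e (?y e) * (?z e - ?y e)) < (\<Sum>e\<in>UNIV. G f F e (?z e))"
    using G_above_tangent by (intro sum_strict_mono_ex1) (auto, metis diff_self le_less mult_zero_right add_0_right)
  moreover have "(q - p) \<bullet> (transpose A *v induced_flow p b) = (\<Sum>e\<in>UNIV. g f e (?y e) * (?z e - ?y e))"
    unfolding inner_incidence[symmetric] by (simp add: diff inner_vec_def induced_flow_def mult.commute)
  ultimately show ?thesis
    by (simp add: energy_def sum.distrib)
qed

lemma inj_energy_gradient: "inj (\<lambda>p. transpose A *v induced_flow p b)"
proof (rule injI, rule ccontr)
  fix p q assume eq: "transpose A *v induced_flow p b = transpose A *v induced_flow q b" and "p \<noteq> q"
  then show False
    using energy_above_tangent[of q p b] energy_above_tangent[of p q b]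
    by (simp add: inner_diff_left)
qed

lemma edge_arg_has_derivative:
  "((\<lambda>(p, b). edge_arg ends c p b e) has_derivative (\<lambda>(v, w). (A *v v + w) $ e)) (at (p, b))"
proof -
  have "((\<lambda>z. edge_arg ends c (fst z) (snd z) e) has_derivative (\<lambda>z. (A *v fst z + snd z) $ e)) (at (p, b))"
    unfolding edge_arg_incidence
    by (auto intro!: derivative_eq_intros bounded_linear.has_derivative[OF matrix_vector_mul_bounded_linear]
        bounded_linear.has_derivative[OF bounded_linear_vec_nth])
  then show ?thesis
    by (simp add: case_prod_unfold)
qed

lemma energy_has_derivative:
  "((\<lambda>(p, b). E p b) has_derivative (\<lambda>(v, w). induced_flow p b \<bullet> (A *v v + w))) (at (p, b))"
proof -
  have "((\<lambda>z. \<Sum>e\<in>UNIV. G f F e ((\<lambda>(p, b). edge_arg ends c p b e) z)) has_derivative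
      (\<lambda>z. \<Sum>e\<in>UNIV. g f e (edge_arg ends c p b e) * (\<lambda>(v, w). (A *v v + w) $ e) z)) (at (p, b))"
    using G_has_derivative
    by (intro has_derivative_sum has_derivative_compose[OF edge_arg_has_derivative])
      (simp add: has_field_derivative_def)
  then show ?thesis
    by (simp add: energy_def induced_flow_def inner_vec_def case_prod_unfold)
qed

lemma GDERIV_energy: "GDERIV (\<lambda>q. E q b) p :> transpose A *v induced_flow p b"
proof -
  have "((\<lambda>q. (q, b)) has_derivative (\<lambda>v. (v, 0))) (at p)"
    by (auto intro!: derivative_eq_intros)
  from has_derivative_compose[OF this energy_has_derivative] show ?thesis
    by (simp add: gderiv_def inner_commute[of "induced_flow p b"] inner_incidence)
qed

text \<open>
  An injective linear map is bounded below, so the edge differences of \<open>p\<close> are at least of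
  order \<open>norm p\<close>, and the superlinear growth of \<open>G\<close> beats the linear term \<open>p \<bullet> x\<close>.
\<close>

lemma energy_coercive: "\<exists>C. \<forall>p. p \<bullet> x - E p b \<le> C - norm p"
proof -
  obtain B where B: "0 < B" "\<And>p. B * norm p \<le> norm (A *v p)"
    using linear_inj_bounded_below_pos[OF matrix_vector_mul_linear inj_incidence] by (metis mult.commute)
  \<comment> \<open>The slope for which the energy outgrows \<open>p \<bullet> x\<close> by a further \<open>norm p\<close>.\<close>
  define M where "M = (norm x + 1) / B"
  define d where "d = b - A *v ground"
  define K where "K = (\<Sum>e\<in>UNIV. max (F e M) (F e (- M)))"
  have "0 \<le> M" using B by (simp add: M_def)
  have "p \<bullet> x - E p b \<le> (K + M * norm d) - norm p" for p
  proof -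
    have arg: "edge_arg ends c p b e = (A *v p + d) $ e" for e
      by (simp add: edge_arg_incidence matrix_vector_mult_diff_distrib d_def)
    have "M * (\<Sum>e\<in>UNIV. \<bar>(A *v p + d) $ e\<bar>) \<le> E p b + K"
      unfolding K_def energy_def sum_distrib_left arg[symmetric] sum.distrib[symmetric]
      by (intro sum_mono G_coercive \<open>0 \<le> M\<close>)
    moreover have "norm (A *v p) - norm d \<le> (\<Sum>e\<in>UNIV. \<bar>(A *v p + d) $ e\<bar>)"
      using norm_le_l1_cart[of "A *v p + d"] norm_diff_ineq[of "A *v p" d] by simp
    ultimately have "M * (B * norm p - norm d) \<le> E p b + K"
      using B(2)[of p] \<open>0 \<le> M\<close> by (smt (verit) mult_left_mono)
    moreover have "M * (B * norm p) = (norm x + 1) * norm p"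
      using B(1) by (simp add: M_def)
    moreover have "p \<bullet> x \<le> norm p * norm x"
      by (rule norm_cauchy_schwarz)
    ultimately show ?thesis
      by (simp add: algebra_simps)
  qed
  then show ?thesis by blast
qed

text \<open>
  The dual objective for \<open>x\<close> is continuous and tends to \<open>-\<infinity>\<close>, so it attains its
  maximum; there its gradient \<open>x - \<nabla>E\<close> vanishes.
\<close>

lemma surj_energy_gradient: "surj (\<lambda>p. transpose A *v induced_flow p b)"
proof -
  have "\<exists>p. transpose A *v induced_flow p b = x" for x
  proof -
    let ?h = "\<lambda>p. p \<bullet> x - E p b"
    have deriv: "(?h has_derivative (\<lambda>v. v \<bullet> (x - transpose A *v induced_flow p b))) (at p)" for p
      using GDERIV_energy[of b p] unfolding gderiv_def
      by (auto intro!: derivative_eq_intros simp: inner_diff_right)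
    have cont: "continuous_on (cball 0 R) ?h" for R
      by (intro continuous_at_imp_continuous_on ballI has_derivative_continuous[OF deriv])
    obtain C where C: "\<And>p. ?h p \<le> C - norm p"
      using energy_coercive by blast
    \<comment> \<open>Outside the ball of this radius the objective is below its value at 0.\<close>
    let ?R = "\<bar>C - ?h 0\<bar>"
    have nonempty: "cball 0 ?R \<noteq> ({} :: (real ^ 'n) set)" by simp
    obtain q where "\<forall>p\<in>cball 0 ?R. ?h p \<le> ?h q"
      using continuous_attains_sup[OF compact_cball nonempty cont] by blast
    then have q: "?h p \<le> ?h q" if "p \<in> cball 0 ?R" for p
      using that by blast
    have "?h p \<le> ?h q" for p
    proof (cases "p \<in> cball 0 ?R")
      case False
      then have "?h p \<le> ?h 0"
        using C[of p] by simp
      also have "\<dots> \<le> ?h q"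
        by (rule q) simp
      finally show ?thesis .
    qed (rule q)
    then have "(\<lambda>v. v \<bullet> (x - transpose A *v induced_flow q b)) = (\<lambda>v. 0)"
      by (intro differential_zero_maxmin[OF _ open_UNIV deriv]) auto
    then have "x - transpose A *v induced_flow q b = 0"
      using fun_cong[of _ _ "x - transpose A *v induced_flow q b"] by fastforce
    then show "\<exists>p. transpose A *v induced_flow p b = x"
      by (intro exI[of _ q]) simp
  qed
  then show ?thesis
    unfolding surj_def by metis
qed

section \<open>Duality and the gradients of the conjugate\<close>

text \<open>
  The sum of the Fenchel inequalities of the edges, for an arbitrary potential and an arbitrary
  flow. The term with \<open>ground\<close> is the contribution of the reference potential; it depends on
  the flow only through its divergence.
\<close>

lemma weak_duality:
  "p \<bullet> (transpose A *v \<phi>) - E p b \<le> ground \<bullet> (transpose A *v \<phi>) + flow_cost F b \<phi>"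
proof -
  have "(\<Sum>e\<in>UNIV. edge_arg ends c p b e * \<phi> $ e) \<le> (\<Sum>e\<in>UNIV. F e (\<phi> $ e)) + E p b"
    unfolding energy_def sum.distrib[symmetric] by (intro sum_mono fenchel)
  moreover have "(\<Sum>e\<in>UNIV. edge_arg ends c p b e * \<phi> $ e) = (p - ground) \<bullet> (transpose A *v \<phi>) + b \<bullet> \<phi>"
    unfolding edge_arg_incidence inner_incidence[symmetric] inner_add_left[symmetric]
    by (simp add: inner_vec_def)
  ultimately show ?thesis
    by (simp add: flow_cost_def sum_subtractf inner_diff_left inner_vec_def[of b])
qed

text \<open>
  Fenchel's inequality is an equality on each edge if the flow is the one induced by the
  potential.
\<close>

lemma strong_duality:
  fixes p :: "real ^ 'n" and b :: "real ^ 'e"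
  defines "\<phi> \<equiv> induced_flow p b"
  shows "p \<bullet> (transpose A *v \<phi>) - E p b = ground \<bullet> (transpose A *v \<phi>) + flow_cost F b \<phi>"
proof -
  have "(\<Sum>e\<in>UNIV. edge_arg ends c p b e * \<phi> $ e) = (\<Sum>e\<in>UNIV. F e (\<phi> $ e)) + E p b"
    unfolding energy_def sum.distrib[symmetric] \<phi>_def induced_flow_def by (simp add: fenchel_eq)
  moreover have "(\<Sum>e\<in>UNIV. edge_arg ends c p b e * \<phi> $ e) = (p - ground) \<bullet> (transpose A *v \<phi>) + b \<bullet> \<phi>"
    unfolding edge_arg_incidence inner_incidence[symmetric] inner_add_left[symmetric]
    by (simp add: inner_vec_def)
  ultimately show ?thesis
    by (simp add: flow_cost_def sum_subtractf inner_diff_left inner_vec_def[of b])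
qed

lemma energy_conj_eq:
  "energy_conj ends f F c (transpose A *v induced_flow p b) b
     = p \<bullet> (transpose A *v induced_flow p b) - E p b"
proof -
  let ?x = "transpose A *v induced_flow p b"
  have "q \<bullet> ?x - E q b \<le> p \<bullet> ?x - E p b" for q
    using weak_duality[of q "induced_flow p b" b] strong_duality[of p b] by simp
  then show ?thesis
    unfolding energy_conj_def by (intro cSup_eq_maximum rangeI) blast
qed

lemma energy_conj_upper:
  "energy_conj ends f F c (transpose A *v \<phi>) b \<le> ground \<bullet> (transpose A *v \<phi>) + flow_cost F b \<phi>"
  unfolding energy_conj_def by (rule cSUP_least[OF UNIV_not_empty weak_duality])

lemma energy_conj_lower: "p \<bullet> x - E p b \<le> energy_conj ends f F c x b"
proof -
  obtain q where q: "x = transpose A *v induced_flow q b"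
    using surjD[OF surj_energy_gradient] by blast
  have "p \<bullet> x - E p b \<le> ground \<bullet> x + flow_cost F b (induced_flow q b)" for p
    unfolding q by (rule weak_duality)
  then have "bdd_above (range (\<lambda>p. p \<bullet> x - E p b))"
    by (rule bdd_aboveI2)
  then show ?thesis
    unfolding energy_conj_def by (rule cSUP_upper[OF UNIV_I])
qed

text \<open>
  Both gradients of \<open>E\<^sup>*\<close> at once. Keeping the potential \<open>p\<close> fixed gives a lower bound for
  \<open>E\<^sup>*\<close> at nearby \<open>(x', b')\<close>. Keeping the flow \<open>\<phi>\<close> fixed, apart from routing the additional
  injection \<open>x' - x\<close> linearly through the network, gives a feasible flow and so by weak duality
  an upper bound. Both bounds are differentiable, touch \<open>E\<^sup>*\<close> at \<open>(x, b)\<close> by strong duality and have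
  the derivative \<open>(v, w) \<mapsto> p \<bullet> v - \<phi> \<bullet> w\<close> there.
\<close>

lemma energy_conj_has_derivative:
  fixes p b
  defines "\<phi> \<equiv> induced_flow p b"
  defines "x \<equiv> transpose A *v \<phi>"
  shows "((\<lambda>(x', b'). energy_conj ends f F c x' b') has_derivative (\<lambda>(v, w). p \<bullet> v - \<phi> \<bullet> w)) (at (x, b))"
proof -
  obtain B where B: "B ** A = mat 1"
    using inj_incidence matrix_left_invertible_injective by blast
  \<comment> \<open>\<open>S\<close> routes an injection: it is a linear choice of a flow with given divergence.\<close>
  define S where "S = transpose B"
  have S: "transpose A *v (S *v v) = v" for v
    using arg_cong[OF B, of transpose]
    by (simp add: S_def matrix_vector_mul_assoc matrix_transpose_mul)
  let ?l = "\<lambda>z. p \<bullet> fst z - E p (snd z)"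
  let ?u = "\<lambda>z. ground \<bullet> fst z + flow_cost F (snd z) (\<phi> + S *v (fst z - x))"
  have "(?l has_derivative (\<lambda>z. p \<bullet> fst z - \<phi> \<bullet> snd z)) (at (x, b))"
  proof -
    have "((\<lambda>z. (p, snd z)) has_derivative (\<lambda>z. (0, snd z))) (at (x, b))"
      by (auto intro!: derivative_eq_intros)
    moreover have "((\<lambda>(p, b). E p b) has_derivative (\<lambda>(v, w). induced_flow p b \<bullet> (A *v v + w))) (at (p, snd (x, b)))"
      using energy_has_derivative by simp
    from has_derivative_compose[OF calculation this]
    have "((\<lambda>z. E p (snd z)) has_derivative (\<lambda>z. \<phi> \<bullet> snd z)) (at (x, b))"
      by (simp add: \<phi>_def)
    then show ?thesis
      by (auto intro!: derivative_eq_intros)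
  qed
  moreover have "(?u has_derivative (\<lambda>z. p \<bullet> fst z - \<phi> \<bullet> snd z)) (at (x, b))"
  proof -
    have "((\<lambda>z. fst z - x) has_derivative fst) (at (x, b))"
      by (auto intro!: derivative_eq_intros)
    then have route: "((\<lambda>z. S *v (fst z - x)) has_derivative (\<lambda>z. S *v fst z)) (at (x, b))"
      by (rule bounded_linear.has_derivative[OF matrix_vector_mul_bounded_linear])
    have Sx: "((\<lambda>z. (\<phi> + S *v (fst z - x)) $ e) has_derivative (\<lambda>z. (S *v fst z) $ e)) (at (x, b))" for e
      by (auto intro!: derivative_eq_intros route bounded_linear.has_derivative[OF bounded_linear_vec_nth])
    have F': "(F e has_derivative (*) (edge_arg ends c p b e)) (at ((\<phi> + S *v (fst (x, b) - x)) $ e))" for e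
      using F_antiderivative[of e "\<phi> $ e"]
      by (simp add: has_field_derivative_def \<phi>_def induced_flow_def)
    have be: "((\<lambda>z. snd z $ e) has_derivative (\<lambda>z. snd z $ e)) (at (x, b))" for e
      by (auto intro!: derivative_eq_intros bounded_linear.has_derivative[OF bounded_linear_vec_nth])
    have "((\<lambda>z. F e ((\<phi> + S *v (fst z - x)) $ e) - snd z $ e * (\<phi> + S *v (fst z - x)) $ e) has_derivative
        (\<lambda>z. edge_arg ends c p b e * (S *v fst z) $ e - (b $ e * (S *v fst z) $ e + snd z $ e * \<phi> $ e))) (at (x, b))" for e
      using has_derivative_diff[OF has_derivative_compose[OF Sx F'] has_derivative_mult[OF be Sx]] by simp
    moreover have "((\<lambda>z. ground \<bullet> fst z) has_derivative (\<lambda>z. ground \<bullet> fst z)) (at (x, b))"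
      by (auto intro!: derivative_eq_intros)
    ultimately have "(?u has_derivative (\<lambda>z. ground \<bullet> fst z + (\<Sum>e\<in>UNIV. edge_arg ends c p b e * (S *v fst z) $ e
        - (b $ e * (S *v fst z) $ e + snd z $ e * \<phi> $ e)))) (at (x, b))"
      unfolding flow_cost_def by (intro has_derivative_add has_derivative_sum)
    moreover have "ground \<bullet> fst z + (\<Sum>e\<in>UNIV. edge_arg ends c p b e * (S *v fst z) $ e
        - (b $ e * (S *v fst z) $ e + snd z $ e * \<phi> $ e)) = p \<bullet> fst z - \<phi> \<bullet> snd z" for z
    proof -
      have "(\<Sum>e\<in>UNIV. edge_arg ends c p b e * (S *v fst z) $ e
          - (b $ e * (S *v fst z) $ e + snd z $ e * \<phi> $ e))
          = (A *v (p - ground)) \<bullet> (S *v fst z) - \<phi> \<bullet> snd z"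
        unfolding edge_arg_incidence inner_vec_def sum_subtractf[symmetric] vector_add_component
        by (simp add: distrib_left mult.commute)
      also have "\<dots> = (p - ground) \<bullet> fst z - \<phi> \<bullet> snd z"
        by (simp add: inner_incidence S)
      finally show ?thesis
        by (simp add: inner_diff_left)
    qed
    ultimately show ?thesis
      by simp
  qed
  ultimately have "((\<lambda>z. energy_conj ends f F c (fst z) (snd z)) has_derivative
      (\<lambda>z. p \<bullet> fst z - \<phi> \<bullet> snd z)) (at (x, b))"
  proof (rule has_derivative_sandwich)
    fix z :: "(real ^ 'n) \<times> (real ^ 'e)"
    have "transpose A *v (\<phi> + S *v (fst z - x)) = fst z"
      by (simp add: matrix_vector_right_distrib S x_def)
    then show "energy_conj ends f F c (fst z) (snd z) \<le> ?u z"
      using energy_conj_upper[of "\<phi> + S *v (fst z - x)" "snd z"] by simp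
    show "?l z \<le> energy_conj ends f F c (fst z) (snd z)"
      by (rule energy_conj_lower)
    show "?l (x, b) = energy_conj ends f F c (fst (x, b)) (snd (x, b))"
      by (simp add: x_def \<phi>_def energy_conj_eq)
    then show "?u (x, b) = energy_conj ends f F c (fst (x, b)) (snd (x, b))"
      using strong_duality[of p b] by (simp add: x_def \<phi>_def)
  qed
  then show ?thesis
    by (simp add: case_prod_unfold)
qed

lemma GDERIV_energy_conj_injection:
  "GDERIV (\<lambda>x. energy_conj ends f F c x b) (transpose A *v induced_flow p b) :> p"
proof -
  have "((\<lambda>x. (x, b)) has_derivative (\<lambda>v. (v, 0))) (at (transpose A *v induced_flow p b))"
    by (auto intro!: derivative_eq_intros)
  from has_derivative_compose[OF this energy_conj_has_derivative] show ?thesis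
    by (simp add: gderiv_def inner_commute)
qed

lemma GDERIV_energy_conj_parameter:
  "GDERIV (energy_conj ends f F c (transpose A *v induced_flow p b)) b :> - induced_flow p b"
proof -
  have "((\<lambda>b'. (transpose A *v induced_flow p b, b')) has_derivative (\<lambda>w. (0, w))) (at b)"
    by (auto intro!: derivative_eq_intros)
  from has_derivative_compose[OF this energy_conj_has_derivative] show ?thesis
    by (simp add: gderiv_def inner_commute)
qed

text \<open>
  The gradient of the cost at the induced flow is, on each edge, a difference of potentials, hence orthogonal
  to the difference of any two flows with the same divergence; strict convexity of \<open>F\<close> does
  the rest.
\<close>

lemma flow_cost_greater:
  assumes "transpose A *v \<phi> = transpose A *v induced_flow p b" and "\<phi> \<noteq> induced_flow p b"
  shows "flow_cost F b (induced_flow p b) < flow_cost F b \<phi>"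
proof -
  let ?\<psi> = "induced_flow p b"
  have arg: "f e (?\<psi> $ e) = (A *v (p - ground) + b) $ e" for e
    by (simp add: induced_flow_def edge_arg_incidence)
  obtain e where "\<phi> $ e \<noteq> ?\<psi> $ e"
    using assms(2) by (auto simp: vec_eq_iff)
  then have "(\<Sum>e\<in>UNIV. F e (?\<psi> $ e) + f e (?\<psi> $ e) * (\<phi> $ e - ?\<psi> $ e)) < (\<Sum>e\<in>UNIV. F e (\<phi> $ e))"
    using F_above_tangent by (intro sum_strict_mono_ex1) (auto, metis diff_self le_less mult_zero_right add_0_right)
  moreover have "(\<Sum>e\<in>UNIV. f e (?\<psi> $ e) * (\<phi> $ e - ?\<psi> $ e)) = (A *v (p - ground) + b) \<bullet> (\<phi> - ?\<psi>)"
    by (simp add: arg inner_vec_def)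
  moreover have "\<dots> = b \<bullet> \<phi> - b \<bullet> ?\<psi>"
    unfolding inner_add_left inner_incidence matrix_vector_mult_diff_distrib[of "transpose A"] assms(1)
    by (simp add: inner_diff_right)
  ultimately show ?thesis
    by (simp add: flow_cost_def sum.distrib sum_subtractf inner_vec_def)
qed

section \<open>The Hessians\<close>

lemma energy_gradient_has_derivative:
  assumes "g_differentiable_at ends f c p b"
  shows "((\<lambda>q. transpose A *v induced_flow q b) has_derivative
    (\<lambda>v. transpose A *v (\<chi> e. deriv (g f e) (edge_arg ends c p b e) * (A *v v) $ e))) (at p)"
proof -
  have "((\<lambda>q. edge_arg ends c q b e) has_derivative (\<lambda>v. (A *v v) $ e)) (at p)" for e
  proof -
    have "((\<lambda>q. (q, b)) has_derivative (\<lambda>v. (v, 0))) (at p)"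
      by (auto intro!: derivative_eq_intros)
    from has_derivative_compose[OF this edge_arg_has_derivative] show ?thesis
      by simp
  qed
  moreover have "(g f e has_derivative (*) (deriv (g f e) (edge_arg ends c p b e))) (at (edge_arg ends c p b e))" for e
    using assms unfolding g_differentiable_at_def has_field_derivative_def[symmetric]
    by (simp add: DERIV_deriv_iff_real_differentiable)
  ultimately have "((\<lambda>q. g f e (edge_arg ends c q b e)) has_derivative
      (\<lambda>v. deriv (g f e) (edge_arg ends c p b e) * (A *v v) $ e)) (at p)" for e
    by (rule has_derivative_compose)
  then have "((\<lambda>q. induced_flow q b) has_derivative
      (\<lambda>v. \<chi> e. deriv (g f e) (edge_arg ends c p b e) * (A *v v) $ e)) (at p)"
    unfolding induced_flow_def
    by (subst has_derivative_componentwise_within) (auto simp: Basis_vec_def inner_axis)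
  then show ?thesis
    by (rule bounded_linear.has_derivative[OF matrix_vector_mul_bounded_linear])
qed

lemma energy_hessian_entry:
  assumes "g_differentiable_at ends f c p b"
  shows "energy_hessian ends f c p b $ i $ j =
    (\<Sum>e\<in>UNIV. orientation ends (Some i) e * deriv (g f e) (edge_arg ends c p b e) * orientation ends (Some j) e)"
proof -
  let ?D = "\<lambda>e. deriv (g f e) (edge_arg ends c p b e)"
  have dg: "dg ends f c p b k l = ?D e" "dg ends f c p b l k = ?D e" if "ends e = (k, l)" for e k l
  proof -
    show "dg ends f c p b k l = ?D e"
      by (simp add: dg_def edge_joining_ends[OF that] signed_ends[OF that] edge_arg_def that)
    have "dg ends f c p b l k = deriv (g f e) (- edge_arg ends c p b e)"
      by (simp add: dg_def edge_joining_ends[OF that] signed_ends[OF that] edge_arg_def that algebra_simps)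
    then show "dg ends f c p b l k = ?D e"
      using assms deriv_g_even by (simp add: g_differentiable_at_def)
  qed
  consider "i = j" | "i \<noteq> j" "Some j \<in> neighbours ends (Some i)" | "i \<noteq> j" "Some j \<notin> neighbours ends (Some i)"
    by blast
  then show ?thesis
  proof cases
    case 1
    have "of_bool (fst (ends e) = Some i) * dg ends f c p b (Some i) (snd (ends e)) +
        of_bool (snd (ends e) = Some i) * dg ends f c p b (Some i) (fst (ends e))
        = orientation ends (Some i) e * ?D e * orientation ends (Some i) e" for e
      using no_loops[of e] dg[OF prod.collapse[symmetric], of e]
      by (cases "fst (ends e) = Some i"; cases "snd (ends e) = Some i") (auto simp: orientation_def)
    then show ?thesis
      using 1 by (simp add: energy_hessian_def sum_neighbours)
  next
    case 2
    then obtain e where e: "ends e = (Some i, Some j) \<or> ends e = (Some j, Some i)"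
      by (auto simp: neighbours_def) metis+
    have zero: "orientation ends (Some i) e' * ?D e' * orientation ends (Some j) e' = 0" if "e' \<noteq> e" for e'
    proof (rule ccontr)
      assume "\<not> ?thesis"
      then have "ends e' = (Some i, Some j) \<or> ends e' = (Some j, Some i)"
        using 2(1) by (auto simp: orientation_def of_bool_def prod_eq_iff split: if_splits)
      then show False
        using that e edge_joining_ends by blast
    qed
    have "(\<Sum>e\<in>UNIV. orientation ends (Some i) e * ?D e * orientation ends (Some j) e)
        = (\<Sum>e\<in>{e}. orientation ends (Some i) e * ?D e * orientation ends (Some j) e)"
      by (rule sum.mono_neutral_right) (use zero in auto)
    also have "\<dots> = - dg ends f c p b (Some i) (Some j)"
      using e 2(1) dg[of e] by (auto simp: orientation_def)
    finally show ?thesis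
      using 2 by (simp add: energy_hessian_def)
  next
    case 3
    have "orientation ends (Some i) e * ?D e * orientation ends (Some j) e = 0" for e
    proof (rule ccontr)
      assume "\<not> ?thesis"
      then have "ends e = (Some i, Some j) \<or> ends e = (Some j, Some i)"
        using 3(1) by (auto simp: orientation_def of_bool_def prod_eq_iff split: if_splits)
      then show False
        using 3(2) by (auto simp: neighbours_def) (metis rangeI)+
    qed
    then have "(\<Sum>e\<in>UNIV. orientation ends (Some i) e * ?D e * orientation ends (Some j) e) = 0"
      by (intro sum.neutral) blast
    then show ?thesis
      using 3 by (simp add: energy_hessian_def)
  qed
qed

text \<open>
  The entrywise Hessian is the weighted graph Laplacian
  \<open>A\<^sup>T diag(g') A\<close>, reduced by the row and column of the reference node.
\<close>

lemma energy_hessian_mult: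
  assumes "g_differentiable_at ends f c p b"
  shows "energy_hessian ends f c p b *v v =
    transpose A *v (\<chi> e. deriv (g f e) (edge_arg ends c p b e) * (A *v v) $ e)"
proof -
  let ?D = "\<lambda>e. deriv (g f e) (edge_arg ends c p b e)"
  have "(energy_hessian ends f c p b *v v) $ i = (transpose A *v (\<chi> e. ?D e * (A *v v) $ e)) $ i" for i
  proof -
    have "(energy_hessian ends f c p b *v v) $ i =
        (\<Sum>j\<in>UNIV. \<Sum>e\<in>UNIV. orientation ends (Some i) e * ?D e * orientation ends (Some j) e * v $ j)"
      by (simp add: matrix_vector_mult_def energy_hessian_entry[OF assms] sum_distrib_right)
    also have "\<dots> = (\<Sum>e\<in>UNIV. \<Sum>j\<in>UNIV. orientation ends (Some i) e * ?D e * orientation ends (Some j) e * v $ j)"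
      by (rule sum.swap)
    also have "\<dots> = (transpose A *v (\<chi> e. ?D e * (A *v v) $ e)) $ i"
      by (simp add: matrix_vector_mult_def transpose_def incidence_def sum_distrib_left mult.assoc)
    finally show ?thesis .
  qed
  then show ?thesis
    by (simp add: vec_eq_iff)
qed

lemma has_hessian_energy:
  assumes "g_differentiable_at ends f c p b"
  shows "has_hessian (\<lambda>q. E q b) (energy_hessian ends f c p b) p"
  unfolding has_hessian_def energy_hessian_mult[OF assms]
  using GDERIV_energy energy_gradient_has_derivative[OF assms] by (intro exI) auto

lemma invertible_energy_hessian:
  assumes "g_differentiable_at ends f c p b"
  shows "invertible (energy_hessian ends f c p b)"
proof -
  let ?H = "energy_hessian ends f c p b" and ?D = "\<lambda>e. deriv (g f e) (edge_arg ends c p b e)"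
  have "v = 0" if "?H *v v = 0" for v
  proof -
    have "0 = v \<bullet> (?H *v v)"
      using that by simp
    also have "\<dots> = (\<Sum>e\<in>UNIV. ?D e * ((A *v v) $ e)\<^sup>2)"
      unfolding energy_hessian_mult[OF assms] inner_incidence[symmetric]
      by (simp add: inner_vec_def power2_eq_square mult.left_commute)
    finally have sum0: "(\<Sum>e\<in>UNIV. ?D e * ((A *v v) $ e)\<^sup>2) = 0" by simp
    have pos: "0 < ?D e" for e
      using assms deriv_g_pos by (simp add: g_differentiable_at_def)
    have "?D e * ((A *v v) $ e)\<^sup>2 = 0" for e
      using sum0 pos by (subst (asm) sum_nonneg_eq_0_iff) (auto simp: less_imp_le)
    then have "A *v v = 0"
      using pos by (simp add: vec_eq_iff less_le)
    then show "v = 0"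
      using inj_incidence by (simp add: linear_injective_0)
  qed
  then show ?thesis
    unfolding invertible_left_inverse matrix_left_invertible_ker by blast
qed

lemma continuous_induced_flow: "continuous_on UNIV (\<lambda>p. induced_flow p b)"
  unfolding induced_flow_def edge_arg_incidence
proof (intro continuous_on_vec_lambda)
  fix e
  have "continuous_on UNIV (g f e)"
    by (simp add: continuous_on_eq_continuous_at isCont_g)
  moreover have "continuous_on UNIV (\<lambda>p. (A *v (p - ground) + b) $ e)"
    by (intro continuous_intros continuous_on_compose2[OF matrix_vector_mult_linear_continuous_on[of UNIV]]) auto
  ultimately show "continuous_on UNIV (\<lambda>p. g f e ((A *v (p - ground) + b) $ e))"
    by (rule continuous_on_compose2) auto
qed

text \<open>
  By \<open>GDERIV_energy_conj_injection\<close> the gradient map of \<open>E\<^sup>*\<close> is globally the inverse of the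
  gradient map of \<open>E\<close>, so its derivative follows from the inverse function theorem. As
  \<open>\<nabla>E\<close> is only known to be differentiable at the single point \<open>p\<close>, the version for
  continuous injective maps is used, which rests on Brouwer's fixed point theorem.
\<close>

lemma has_hessian_energy_conj:
  assumes "g_differentiable_at ends f c p b"
  shows "has_hessian (\<lambda>x. energy_conj ends f F c x b) (matrix_inv (energy_hessian ends f c p b))
    (transpose A *v induced_flow p b)"
proof -
  let ?H = "energy_hessian ends f c p b"
  define grad where "grad = (\<lambda>p. transpose A *v induced_flow p b)"
  have bij: "bij grad"
    unfolding grad_def by (simp add: bij_def inj_energy_gradient surj_energy_gradient)
  have inv: "grad (inv grad x) = x" "inv grad (grad q) = q" for x q
    using bij by (simp_all add: bij_is_surj surj_f_inv_f bij_is_inj)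
  have "GDERIV (\<lambda>x. energy_conj ends f F c x b) x :> inv grad x" for x
    using GDERIV_energy_conj_injection[of b "inv grad x"] inv(1)[of x] by (simp add: grad_def)
  moreover have "(inv grad has_derivative (\<lambda>v. matrix_inv ?H *v v)) (at (grad p))"
  proof (rule has_derivative_inverse_strong[where f = grad and x = p, OF open_UNIV UNIV_I])
    show "continuous_on UNIV grad"
      unfolding grad_def using continuous_induced_flow
      by (intro continuous_on_compose2[OF matrix_vector_mult_linear_continuous_on[of UNIV]]) auto
    show "(grad has_derivative (\<lambda>v. ?H *v v)) (at p)"
      unfolding energy_hessian_mult[OF assms]
      using energy_gradient_has_derivative[OF assms] by (simp add: grad_def)
    have "?H ** matrix_inv ?H = mat 1"
      using invertible_energy_hessian[OF assms] unfolding invertible_def matrix_inv_def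
      by (metis (mono_tags, lifting) someI_ex)
    then show "(\<lambda>v. ?H *v v) \<circ> (\<lambda>v. matrix_inv ?H *v v) = id"
      by (simp add: fun_eq_iff matrix_vector_mul_assoc)
  qed (rule inv)
  ultimately show ?thesis
    unfolding has_hessian_def by (intro exI[of _ "inv grad"] conjI always_eventually) (auto simp: grad_def)
qed

end

section \<open>Optima, gradients and Hessians of the conjugate energy\<close>

theorem lemma1:
  fixes ends :: "'e::finite \<Rightarrow> 'n::finite option \<times> 'n option"
    and f F :: "'e \<Rightarrow> real \<Rightarrow> real"
    and c :: real
    and x :: "real ^ 'n"
    and b :: "real ^ 'e"
  assumes "dissipative_flow_network ends f F"
  shows "\<exists>(\<phi>opt :: real ^ 'e) (\<pi>opt :: real ^ 'n).
    (\<forall>\<phi>. is_arg_min (flow_cost F b) (flow_feasible ends x) \<phi> \<longleftrightarrow> \<phi> = \<phi>opt) \<and>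
    (\<forall>\<pi>. is_arg_max (\<lambda>p. p \<bullet> x - energy ends f F c p b) (\<lambda>_. True) \<pi> \<longleftrightarrow> \<pi> = \<pi>opt) \<and>
    GDERIV (\<lambda>x'. energy_conj ends f F c x' b) x :> \<pi>opt \<and>
    GDERIV (\<lambda>b'. energy_conj ends f F c x b') b :> - \<phi>opt \<and>
    (\<forall>\<pi>. g_differentiable_at ends f c \<pi> b \<longrightarrow>
      has_hessian (\<lambda>p. energy ends f F c p b) (energy_hessian ends f c \<pi> b) \<pi>) \<and>
    (g_differentiable_at ends f c \<pi>opt b \<longrightarrow>
      invertible (energy_hessian ends f c \<pi>opt b) \<and>
      has_hessian (\<lambda>x'. energy_conj ends f F c x' b)
        (matrix_inv (energy_hessian ends f c \<pi>opt b)) x) \<and>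
    (\<forall>\<pi>. energy ends f F c \<pi> b + energy_conj ends f F c x b - \<pi> \<bullet> x \<le> 0 \<longleftrightarrow> \<pi> = \<pi>opt)"
proof -
  interpret grounded_flow_network ends f F c
    using assms by (rule grounded_flow_network.intro)
  obtain q where x: "x = transpose A *v induced_flow q b"
    using surjD[OF surj_energy_gradient] by blast
  have conj: "energy_conj ends f F c x b = q \<bullet> x - E q b"
    using energy_conj_eq[of q b] by (simp add: x)
  have dual_less: "p \<bullet> x - E p b < q \<bullet> x - E q b" if "p \<noteq> q" for p
    using energy_above_tangent[OF that, of b] x by (simp add: inner_diff_left)
  have "is_arg_min (flow_cost F b) (flow_feasible ends x) \<phi> \<longleftrightarrow> \<phi> = induced_flow q b" for \<phi>
    using flow_cost_greater[of _ q b] x unfolding is_arg_min_def flow_feasible_iff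
    by (metis less_asym)
  moreover have "is_arg_max (\<lambda>p. p \<bullet> x - E p b) (\<lambda>_. True) p \<longleftrightarrow> p = q" for p
    using dual_less unfolding is_arg_max_def by (metis less_asym)
  moreover have "E p b + energy_conj ends f F c x b - p \<bullet> x \<le> 0 \<longleftrightarrow> p = q" for p
    using dual_less[of p] by (cases "p = q") (auto simp: conj)
  moreover have "GDERIV (\<lambda>x'. energy_conj ends f F c x' b) x :> q"
    using GDERIV_energy_conj_injection[of b q] by (simp add: x)
  moreover have "GDERIV (\<lambda>b'. energy_conj ends f F c x b') b :> - induced_flow q b"
    using GDERIV_energy_conj_parameter[of q b] by (simp add: x)
  ultimately show ?thesis
    using has_hessian_energy[of _ b] invertible_energy_hessian[of q b] has_hessian_energy_conj[of q b] x
    by (intro exI[of _ "induced_flow q b"] exI[of _ q]) auto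
qed

end
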